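(* If $\alpha<-1$ and $c\ge 1$, then $L_{\alpha,c}(x)=O\big(|x|^{-\lceil 2|\alpha|-2\rceil}\big)$ as $|x|\to\infty$.
   Context: For $c>0$ and $\alpha\in\mathbb{R}\setminus\{0,1,2,\dots\}$, the one-dimensional general multiquadric $\phi_{\alpha,c}(x)=(x^2+c^2)^\alpha$ has (generalized) Fourier transform $$\widehat{\phi}_{\alpha,c}(\xi)=\frac{2^{1+\alpha}}{\Gamma(-\alpha)}\Big(\frac{c}{|\xi|}\Big)^{\alpha+\frac12}K_{\alpha+\frac12}(c|\xi|),\quad \xi\neq 0,$$ where $K_\nu=K_{-\nu}$ is the modified Bessel function of the second kind. Set $$\widehat{L}_{\alpha,c}(\xi)=\frac{\widehat{\phi}_{\alpha,c}(\xi)}{\sum_{j\in\mathbb{Z}}\widehat{\phi}_{\alpha,c}(\xi+2\pi j)},\quad\xi\in\mathbb{R}$$ (extended by continuity to $\xi\in2\pi\mathbb{Z}$). This is in $L_1(\mathbb{R})$, and the fundamental function is $L_{\alpha,c}(x)=\frac1{2\pi}\int_{\mathbb{R}}\widehat{L}_{\alpha,c}(\xi)e^{ix\xi}d\xi$. *)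

theory Defs
  imports "HOL-Analysis.Analysis" "HOL-Library.Landau_Symbols"
begin

text \<open>Modified Bessel function of the second kind, for real order and argument \<open>r > 0\<close>.\<close>

definition bessel_K :: "real \<Rightarrow> real \<Rightarrow> real" where
  "bessel_K \<nu> r = (LBINT t:{0..}. exp (- r * cosh t) * cosh (\<nu> * t))"

text \<open>
  Generalized Fourier transform of \<open>x \<mapsto> (x\<^sup>2 + c\<^sup>2) powr \<alpha>\<close> away from the origin, normalised
  as \<open>(2 * pi) powr (- 1 / 2) * (\<integral> \<dots> exp (- \<i> * x * \<xi>) dx)\<close> where that integral exists.
  The value at \<open>\<xi> = 0\<close> is a dummy and is never used below.
\<close>

definition mq_hat :: "real \<Rightarrow> real \<Rightarrow> real \<Rightarrow> real" where
  "mq_hat \<alpha> c \<xi> =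
     2 powr (1 + \<alpha>) / Gamma (- \<alpha>) * (c / \<bar>\<xi>\<bar>) powr (\<alpha> + 1 / 2)
       * bessel_K (\<alpha> + 1 / 2) (c * \<bar>\<xi>\<bar>)"

definition mq_quotient :: "real \<Rightarrow> real \<Rightarrow> real \<Rightarrow> real" where
  "mq_quotient \<alpha> c \<xi> = mq_hat \<alpha> c \<xi> / (\<Sum>\<^sub>\<infinity>j::int. mq_hat \<alpha> c (\<xi> + 2 * pi * of_int j))"

text \<open>
  On \<open>2 * pi * \<int>\<close> some term of the denominator sits at the origin; there the value is the limit
  of the quotient, taken over a punctured neighbourhood (which avoids \<open>2 * pi * \<int>\<close>).
\<close>

definition fundamental_hat :: "real \<Rightarrow> real \<Rightarrow> real \<Rightarrow> real" where
  "fundamental_hat \<alpha> c \<xi> =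
     (if \<exists>k::int. \<xi> = 2 * pi * of_int k
      then Lim (at \<xi>) (mq_quotient \<alpha> c)
      else mq_quotient \<alpha> c \<xi>)"

definition fundamental :: "real \<Rightarrow> real \<Rightarrow> real \<Rightarrow> complex" where
  "fundamental \<alpha> c x =
     1 / (2 * of_real pi) *
       (LBINT \<xi>. of_real (fundamental_hat \<alpha> c \<xi>) * exp (\<i> * of_real x * of_real \<xi>))"

end

theory Submission
  imports Defs "HOL-Real_Asymp.Real_Asymp"
begin

text \<open>
  With \<open>\<nu> = - \<alpha> - 1 / 2 > 1 / 2\<close>, the transform \<open>mq_hat \<alpha> c\<close> is away from \<open>0\<close> a positive multiple of
  \<open>\<Phi> \<xi> = \<integral> exp (\<nu> * t - exp t - c\<^sup>2 * \<xi>\<^sup>2 / 4 * exp (- t)) dt\<close>, a mixture of Gaussians. The \<open>m\<close>-th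
  derivative of such a Gaussian in \<open>\<xi>\<close> costs a factor \<open>exp (- m * t / 2)\<close>, which the mixing weight absorbs
  as long as \<open>m < 2 * \<nu>\<close>; so \<open>\<Phi>\<close> has \<open>\<lceil>2 * \<bar>\<alpha>\<bar> - 2\<rceil>\<close> continuous derivatives, all decaying
  exponentially. The denominator is the periodization of \<open>\<Phi>\<close>: equally smooth, with bounded derivatives
  and a positive lower bound. Hence the quotient inherits smoothness and decay from \<open>\<Phi>\<close>, and each
  integration by parts in the Fourier integral gains a factor \<open>1 / \<bar>x\<bar>\<close>. The values on
  \<open>2 * pi * \<int>\<close> are irrelevant because that set is null.
\<close>

subsection \<open>Differentiable functions with dominated derivatives\<close>

text \<open>One predicate carries smoothness and decay together, so that each closure rule is a
  single induction on the order. Continuity is demanded only of the last derivative; the earlier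
  ones are differentiable anyway.\<close>

primrec bounded_derivs :: "nat \<Rightarrow> (real \<Rightarrow> real) \<Rightarrow> (real \<Rightarrow> real) \<Rightarrow> bool" where
  "bounded_derivs 0 w f \<longleftrightarrow> continuous_on UNIV f \<and> (\<exists>C. \<forall>x. \<bar>f x\<bar> \<le> C * w x)"
| "bounded_derivs (Suc k) w f \<longleftrightarrow> (\<exists>C. \<forall>x. \<bar>f x\<bar> \<le> C * w x) \<and>
     (\<exists>f'. (\<forall>x. (f has_field_derivative f' x) (at x)) \<and> bounded_derivs k w f')"

lemma bounded_derivs_SucI:
  assumes "\<exists>C. \<forall>x. \<bar>f x\<bar> \<le> C * w x" "\<And>x. (f has_field_derivative f' x) (at x)"
    "bounded_derivs k w f'"
  shows "bounded_derivs (Suc k) w f"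
  unfolding bounded_derivs.simps by (intro conjI assms(1) exI[of _ f'] allI assms(2,3))

lemma bounded_derivs_bound:
  assumes "bounded_derivs k w f"
  obtains C where "\<And>x. \<bar>f x\<bar> \<le> C * w x"
  using assms by (cases k) auto

lemma bounded_derivs_continuous: "bounded_derivs k w f \<Longrightarrow> continuous_on UNIV f"
proof (cases k)
  case (Suc n)
  assume "bounded_derivs k w f"
  then obtain f' where "\<And>x. (f has_field_derivative f' x) (at x)" using Suc by auto
  then show ?thesis by (rule DERIV_continuous_on)
qed simp

lemma bounded_derivs_Suc_imp: "bounded_derivs (Suc k) w f \<Longrightarrow> bounded_derivs k w f"
proof (induction k arbitrary: f)
  case 0
  then show ?case using bounded_derivs_continuous[OF 0] by simp
next
  case (Suc k)
  from Suc.prems obtain f' where f': "\<And>x. (f has_field_derivative f' x) (at x)" "bounded_derivs (Suc k) w f'"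
    unfolding bounded_derivs.simps(2)[of "Suc k"] by blast
  then show ?case
    using Suc.prems by (intro bounded_derivs_SucI[of f w f'] Suc.IH) auto
qed

lemma bounded_derivs_add:
  assumes "bounded_derivs k w f" "bounded_derivs k w g"
  shows "bounded_derivs k w (\<lambda>x. f x + g x)"
proof -
  have bnd: "\<exists>C. \<forall>x. \<bar>f x + g x\<bar> \<le> C * w x"
    if bd: "\<exists>C. \<forall>x. \<bar>f x\<bar> \<le> C * w x" "\<exists>C. \<forall>x. \<bar>g x\<bar> \<le> C * w x" for f g :: "real \<Rightarrow> real"
  proof -
    obtain C D where "\<And>x. \<bar>f x\<bar> \<le> C * w x" "\<And>x. \<bar>g x\<bar> \<le> D * w x"
      using bd by blast
    then have "\<bar>f x\<bar> + \<bar>g x\<bar> \<le> (C + D) * w x" for x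
      unfolding distrib_right by (intro add_mono)
    then have "\<bar>f x + g x\<bar> \<le> (C + D) * w x" for x
      using abs_triangle_ineq order_trans by blast
    then show ?thesis by blast
  qed
  show ?thesis using assms
  proof (induction k arbitrary: f g)
    case 0
    then show ?case using bnd[of f g] by (simp add: continuous_intros)
  next
    case (Suc k)
    then obtain f' g' where *: "\<And>x. (f has_field_derivative f' x) (at x)" "bounded_derivs k w f'"
      "\<And>x. (g has_field_derivative g' x) (at x)" "bounded_derivs k w g'" by auto
    show ?case
    proof (rule bounded_derivs_SucI)
      show "\<exists>C. \<forall>x. \<bar>f x + g x\<bar> \<le> C * w x"
        by (rule bnd) (use Suc.prems in simp_all)
      show "((\<lambda>x. f x + g x) has_field_derivative f' x + g' x) (at x)" for x
        by (intro DERIV_add *)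
      show "bounded_derivs k w (\<lambda>x. f' x + g' x)" by (intro Suc.IH *)
    qed
  qed
qed

text \<open>Each summand of the product rule contains one undifferentiated factor, whose order is
  lowered by \<open>bounded_derivs_Suc_imp\<close> before the induction hypothesis applies. Weights
  multiply, so a decaying function times a bounded one keeps its decay.\<close>

lemma bounded_derivs_mult:
  assumes "bounded_derivs k v f" "bounded_derivs k w g"
  shows "bounded_derivs k (\<lambda>x. v x * w x) (\<lambda>x. f x * g x)"
proof -
  have bnd: "\<exists>C. \<forall>x. \<bar>f x * g x\<bar> \<le> C * (v x * w x)"
    if bd: "\<exists>C. \<forall>x. \<bar>f x\<bar> \<le> C * v x" "\<exists>C. \<forall>x. \<bar>g x\<bar> \<le> C * w x" for f g :: "real \<Rightarrow> real"
  proof -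
    obtain C D where *: "\<And>x. \<bar>f x\<bar> \<le> C * v x" "\<And>x. \<bar>g x\<bar> \<le> D * w x"
      using bd by blast
    have "\<bar>f x * g x\<bar> \<le> (C * D) * (v x * w x)" for x
    proof -
      have "\<bar>f x\<bar> * \<bar>g x\<bar> \<le> (C * v x) * (D * w x)"
        by (rule mult_mono) (use * in \<open>auto intro: order_trans[OF abs_ge_zero]\<close>)
      then show ?thesis by (simp add: abs_mult mult_ac)
    qed
    then show ?thesis by blast
  qed
  show ?thesis using assms
  proof (induction k arbitrary: f g)
    case 0
    then show ?case using bnd[of f g] by (simp add: continuous_intros)
  next
    case (Suc k)
    then obtain f' g' where *: "\<And>x. (f has_field_derivative f' x) (at x)" "bounded_derivs k v f'"
      "\<And>x. (g has_field_derivative g' x) (at x)" "bounded_derivs k w g'" by auto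
    show ?case
    proof (rule bounded_derivs_SucI)
      show "\<exists>C. \<forall>x. \<bar>f x * g x\<bar> \<le> C * (v x * w x)"
        by (rule bnd) (use Suc.prems in simp_all)
      show "((\<lambda>x. f x * g x) has_field_derivative f x * g' x + f' x * g x) (at x)" for x
        by (intro DERIV_mult' *)
      show "bounded_derivs k (\<lambda>x. v x * w x) (\<lambda>x. f x * g' x + f' x * g x)"
        by (intro bounded_derivs_add Suc.IH * Suc.prems[THEN bounded_derivs_Suc_imp])
    qed
  qed
qed

lemma bounded_derivs_const: "bounded_derivs k (\<lambda>x. 1) (\<lambda>x. a)"
proof (induction k arbitrary: a)
  case (Suc k)
  show ?case by (rule bounded_derivs_SucI[OF _ _ Suc[of 0]]) auto
qed auto

text \<open>The derivative \<open>- f' / f^2\<close> is a product of \<open>f'\<close> and two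
  copies of \<open>inverse f\<close>, to which the induction hypothesis applies at one order
  less.\<close>

lemma bounded_derivs_inverse:
  assumes "bounded_derivs k (\<lambda>x. 1) f" "\<delta> > 0" "\<And>x. f x \<ge> \<delta>"
  shows "bounded_derivs k (\<lambda>x. 1) (\<lambda>x. inverse (f x))"
proof -
  have pos: "f x \<noteq> 0" for x using assms(2) assms(3)[of x] by linarith
  have bnd: "\<exists>C. \<forall>x. \<bar>inverse (f x)\<bar> \<le> C * 1"
    using assms(2,3) by (intro exI[of _ "inverse \<delta>"]) (auto intro!: le_imp_inverse_le simp: abs_of_pos less_le_trans)
  show ?thesis using assms(1)
  proof (induction k)
    case 0
    then show ?case using bnd pos by (auto intro!: continuous_intros)
  next
    case (Suc k)
    then obtain f' where *: "\<And>x. (f has_field_derivative f' x) (at x)" "bounded_derivs k (\<lambda>x. 1) f'"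
      by auto
    have i: "bounded_derivs k (\<lambda>x. 1) (\<lambda>x. inverse (f x))"
      by (rule Suc.IH) (rule bounded_derivs_Suc_imp[OF Suc.prems])
    \<comment> \<open>The unsimplified weight mirrors the nesting of the four-fold product, as
      \<open>bounded_derivs_mult\<close> produces it.\<close>
    have "bounded_derivs k (\<lambda>x. 1 * (1 * (1 * 1))) (\<lambda>x. -1 * (inverse (f x) * (f' x * inverse (f x))))"
      by (intro bounded_derivs_mult bounded_derivs_const i *)
    moreover have "((\<lambda>x. inverse (f x)) has_field_derivative -1 * (inverse (f x) * (f' x * inverse (f x)))) (at x)" for x
      using DERIV_inverse'[OF *(1) pos, of x] by (simp add: mult.assoc)
    ultimately show ?case
      by (intro bounded_derivs_SucI[OF bnd]) simp_all
  qed
qed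

section \<open>Integrable majorants and parameter-dependent integrals\<close>

lemma integrable_exp_abs:
  fixes \<mu> :: real
  assumes "\<mu> > 0"
  shows "integrable lborel (\<lambda>x. exp (- \<mu> * \<bar>x\<bar>))"
proof -
  have "(\<lambda>x. exp (- \<mu> * x)) absolutely_integrable_on {0..}"
    by (rule nonnegative_absolutely_integrable_1[OF integrable_on_exp_minus_to_infinity[OF assms]]) auto
  then have 1: "integrable lborel (\<lambda>x. indicator {0..} x * exp (- \<mu> * x))"
    by (subst integrable_completion[symmetric]) (auto simp: set_integrable_def)
  \<comment> \<open>The two half-lines overlap at \<open>0\<close>, so the sum is only a majorant,
    which suffices.\<close>
  have "integrable lborel (\<lambda>x. indicator {0..} x * exp (- \<mu> * x) + indicator {0..} (-x) * exp (- \<mu> * (- x)))"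
    using 1 lborel_integrable_real_affine[OF 1, of "-1" 0] by simp
  then show ?thesis
    by (rule Bochner_Integration.integrable_bound) (auto simp: indicator_def)
qed

text \<open>On the left the factor \<open>exp (a * t)\<close> decays, on the right
  \<open>exp t\<close> beats every linear term; both sides fit under one multiple of
  \<open>exp (- a * \<bar>t\<bar>)\<close>.\<close>

lemma integrable_exp_minus_exp:
  fixes a b :: real
  assumes "a > 0" "b > 0"
  shows "integrable lborel (\<lambda>t. exp (a * t - b * exp t))"
proof (rule Bochner_Integration.integrable_bound)
  show "integrable lborel (\<lambda>t. exp (2 * a\<^sup>2 / b) * exp (- a * \<bar>t\<bar>))"
    by (intro integrable_mult_right integrable_exp_abs assms)
  have "a * t - b * exp t \<le> 2 * a\<^sup>2 / b - a * \<bar>t\<bar>" for t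
  proof (cases "t \<le> 0")
    case True
    then show ?thesis using assms
      by (simp add: abs_of_nonpos) (smt (verit) divide_nonneg_pos exp_gt_zero mult_pos_pos zero_le_power2)
  next
    case False
    have "t\<^sup>2 / 2 \<le> exp t"
      using exp_lower_Taylor_quadratic[of t] False by simp
    then have "b * (t\<^sup>2 / 2) \<le> b * exp t" using assms by simp
    \<comment> \<open>Completing the square: \<open>2 * a * t - b * t^2 / 2\<close> is maximal at
      \<open>t = 2 * a / b\<close>, and its value there is the constant in the majorant.\<close>
    moreover have "0 \<le> (b * t - 2 * a)\<^sup>2 / (2 * b)" using assms by simp
    then have "2 * a * t - b * (t\<^sup>2/2) \<le> 2 * a\<^sup>2 / b"
      using assms by (simp add: field_simps power2_eq_square)
    ultimately show ?thesis using False by simp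
  qed
  then show "AE t in lborel. norm (exp (a * t - b * exp t)) \<le> norm (exp (2 * a\<^sup>2 / b) * exp (- a * \<bar>t\<bar>))"
    by (simp add: exp_add[symmetric])
qed auto

text \<open>The mean value inequality bounds every difference quotient by \<open>w\<close>, so
  dominated convergence applies along any sequence tending to \<open>x\<close>.\<close>

lemma has_field_derivative_integral_dominated:
  fixes f f' :: "real \<Rightarrow> 'a \<Rightarrow> real"
  assumes int: "\<And>x. integrable M (f x)"
    and deriv: "\<And>x t. ((\<lambda>x. f x t) has_field_derivative f' x t) (at x)"
    and meas: "\<And>x. f' x \<in> borel_measurable M"
    and dom: "\<And>x t. \<bar>f' x t\<bar> \<le> w t" "integrable M w"
  shows "((\<lambda>x. \<integral>t. f x t \<partial>M) has_field_derivative (\<integral>t. f' x t \<partial>M)) (at x)"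
proof -
  note [measurable] = meas borel_measurable_integrable[OF int]
  have "((\<lambda>y. ((\<integral>t. f y t \<partial>M) - (\<integral>t. f x t \<partial>M)) / (y - x)) \<longlongrightarrow> (\<integral>t. f' x t \<partial>M)) (at x)"
    unfolding tendsto_at_iff_sequentially
  proof (intro allI impI)
    fix X :: "nat \<Rightarrow> real" assume X: "\<forall>i. X i \<in> UNIV - {x}" "X \<longlonglongrightarrow> x"
    have "(\<lambda>i. \<integral>t. (f (X i) t - f x t) / (X i - x) \<partial>M) \<longlonglongrightarrow> (\<integral>t. f' x t \<partial>M)"
    proof (rule integral_dominated_convergence[OF _ _ dom(2)])
      show "AE t in M. (\<lambda>i. (f (X i) t - f x t) / (X i - x)) \<longlonglongrightarrow> f' x t"
        using deriv[of _ x] X unfolding has_field_derivative_iff tendsto_at_iff_sequentially comp_def by simp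
      have "\<bar>f y t - f x t\<bar> \<le> w t * \<bar>y - x\<bar>" for y t
        using field_differentiable_bound[of UNIV "\<lambda>x. f x t" "\<lambda>x. f' x t" "w t" y x] deriv dom(1) by simp
      then show "AE t in M. norm ((f (X i) t - f x t) / (X i - x)) \<le> w t" for i
        using X(1) by (simp add: pos_divide_le_eq)
    qed measurable
    then show "((\<lambda>y. ((\<integral>t. f y t \<partial>M) - (\<integral>t. f x t \<partial>M)) / (y - x)) \<circ> X) \<longlonglongrightarrow> (\<integral>t. f' x t \<partial>M)"
      by (simp add: comp_def int)
  qed
  then show "((\<lambda>x. \<integral>t. f x t \<partial>M) has_field_derivative (\<integral>t. f' x t \<partial>M)) (at x)"
    by (simp add: has_field_derivative_iff)
qed

lemma continuous_on_integral_dominated: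
  fixes f :: "real \<Rightarrow> 'a \<Rightarrow> real"
  assumes cont: "\<And>t. continuous_on UNIV (\<lambda>x. f x t)"
    and meas: "\<And>x. f x \<in> borel_measurable M"
    and dom: "\<And>x t. \<bar>f x t\<bar> \<le> w t" "integrable M w"
  shows "continuous_on UNIV (\<lambda>x. \<integral>t. f x t \<partial>M)"
  unfolding continuous_on_sequentially comp_def
proof safe
  fix X :: "nat \<Rightarrow> real" and x assume X: "X \<longlonglongrightarrow> x"
  show "(\<lambda>i. \<integral>t. f (X i) t \<partial>M) \<longlonglongrightarrow> (\<integral>t. f x t \<partial>M)"
  proof (rule integral_dominated_convergence[OF _ _ dom(2)])
    show "AE t in M. (\<lambda>i. f (X i) t) \<longlonglongrightarrow> f x t"
      using cont X unfolding continuous_on_sequentially comp_def by simp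
  qed (use meas dom in auto)
qed

section \<open>Decay of Fourier integrals\<close>

lemma bounded_derivs_integrable:
  assumes "bounded_derivs k w f" "integrable lborel w"
  shows "integrable lborel f"
proof -
  obtain C where C: "\<And>x. \<bar>f x\<bar> \<le> C * w x" using bounded_derivs_bound assms by blast
  have "f \<in> borel_measurable borel"
    by (rule borel_measurable_continuous_onI) (rule bounded_derivs_continuous[OF assms(1)])
  moreover have "norm (f x) \<le> norm (C * w x)" for x
    using C[of x] by simp
  ultimately show ?thesis
    by (intro Bochner_Integration.integrable_bound[of _ "\<lambda>x. C * w x" f] integrable_mult_right assms(2)) simp_all
qed

text \<open>Repeated integration by parts. The boundary terms vanish because \<open>f\<close> is
  dominated by \<open>w\<close>, which tends to \<open>0\<close> at both ends; the base case is the
  trivial bound by the integral of \<open>\<bar>f\<bar>\<close>.\<close>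

lemma fourier_integral_bound:
  assumes "bounded_derivs k w f" "integrable lborel w"
    and lim: "(w \<longlongrightarrow> 0) at_top" "(w \<longlongrightarrow> 0) at_bot"
  shows "\<exists>C. \<forall>x. x \<noteq> 0 \<longrightarrow>
           norm (LBINT \<xi>. of_real (f \<xi>) * exp (\<i> * of_real x * of_real \<xi>)) \<le> C / \<bar>x\<bar> ^ k"
  using assms(1)
proof (induction k arbitrary: f)
  case 0
  have "norm (LBINT \<xi>. of_real (f \<xi>) * exp (\<i> * of_real x * of_real \<xi>)) \<le> (LBINT \<xi>. \<bar>f \<xi>\<bar>)" for x
    by (rule order_trans[OF integral_norm_bound]) (simp add: norm_mult)
  then show ?case by auto
next
  case (Suc k)
  obtain f' where f': "\<And>x. (f has_field_derivative f' x) (at x)" "bounded_derivs k w f'"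
    using Suc.prems by auto
  obtain B where B: "\<And>x. \<bar>f x\<bar> \<le> B * w x" using bounded_derivs_bound Suc.prems by blast
  obtain C where C: "\<And>x. x \<noteq> 0 \<Longrightarrow>
      norm (LBINT \<xi>. of_real (f' \<xi>) * exp (\<i> * of_real x * of_real \<xi>)) \<le> C / \<bar>x\<bar> ^ k"
    using Suc.IH[OF f'(2)] by auto
  have int: "integrable lborel (\<lambda>\<xi>. of_real (g \<xi>) * exp (\<i> * of_real x * of_real \<xi>))"
    if "integrable lborel g" for g :: "real \<Rightarrow> real" and x
    by (rule Bochner_Integration.integrable_bound[OF that]) (use that in \<open>auto simp: norm_mult\<close>)
  have "norm (LBINT \<xi>. of_real (f \<xi>) * exp (\<i> * of_real x * of_real \<xi>)) \<le> C / \<bar>x\<bar> ^ Suc k" if "x \<noteq> 0" for x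
  proof -
    define e where "e \<xi> = exp (\<i> * of_real x * of_real \<xi>)" for \<xi>
    have e1: "norm (e \<xi>) = 1" for \<xi> by (simp add: e_def)
    have ce: "isCont e \<xi>" for \<xi> unfolding e_def by (intro continuous_intros)
    have cf: "isCont f \<xi>" "isCont f' \<xi>" for \<xi>
      using bounded_derivs_continuous[OF Suc.prems] bounded_derivs_continuous[OF f'(2)]
      by (auto simp: continuous_on_eq_continuous_at)
    have i: "integrable lborel (\<lambda>\<xi>. of_real (f \<xi>) * e \<xi>)" "integrable lborel (\<lambda>\<xi>. of_real (f' \<xi>) * e \<xi>)"
      unfolding e_def using bounded_derivs_integrable[OF Suc.prems assms(2)] bounded_derivs_integrable[OF f'(2) assms(2)]
      by (auto intro: int)
    have lim0: "((\<lambda>\<xi>. of_real (f \<xi>) * e \<xi>) \<longlongrightarrow> 0) F" if "(w \<longlongrightarrow> 0) F" for F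
      by (rule Lim_null_comparison[where g = "\<lambda>x. B * w x"])
        (use B tendsto_mult_left[OF that, of B] in \<open>auto simp: norm_mult e1\<close>)
    \<comment> \<open>The integrand is the derivative of \<open>f * e\<close>, so its integral over
      the line is the difference of two vanishing limits.\<close>
    have "(LBINT \<xi>=-\<infinity>..\<infinity>. of_real (f' \<xi>) * e \<xi> + \<i> * of_real x * (of_real (f \<xi>) * e \<xi>)) = 0 - 0"
    proof (rule interval_integral_FTC_integrable[where F = "\<lambda>\<xi>. of_real (f \<xi>) * e \<xi>"])
      show "((\<lambda>\<xi>. of_real (f \<xi>) * e \<xi>) has_vector_derivative
          of_real (f' \<xi>) * e \<xi> + \<i> * of_real x * (of_real (f \<xi>) * e \<xi>)) (at \<xi>)" for \<xi>
      proof -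
        have 1: "((\<lambda>\<xi>. of_real (f \<xi>) :: complex) has_vector_derivative of_real (f' \<xi>)) (at \<xi>)"
          by (rule has_vector_derivative_of_real) (rule f'(1))
        have "((\<lambda>z. exp (\<i> * of_real x * z)) has_field_derivative \<i> * of_real x * e \<xi>) (at (of_real \<xi>))"
          by (auto intro!: derivative_eq_intros simp: e_def)
        then have 2: "(e has_vector_derivative \<i> * of_real x * e \<xi>) (at \<xi>)"
          unfolding e_def by (rule has_vector_derivative_real_field)
        show ?thesis
          using has_vector_derivative_mult[OF 1 2] by (simp add: algebra_simps)
      qed
      show "isCont (\<lambda>\<xi>. of_real (f' \<xi>) * e \<xi> + \<i> * of_real x * (of_real (f \<xi>) * e \<xi>)) \<xi>" for \<xi>
        using cf ce by (intro continuous_intros) auto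
      show "set_integrable lborel (einterval (- \<infinity>) \<infinity>) (\<lambda>\<xi>. of_real (f' \<xi>) * e \<xi> + \<i> * of_real x * (of_real (f \<xi>) * e \<xi>))"
        using i by (auto simp: set_integrable_def)
      show "(((\<lambda>\<xi>. of_real (f \<xi>) * e \<xi>) \<circ> real_of_ereal) \<longlongrightarrow> 0) (at_right (- \<infinity>))"
        "(((\<lambda>\<xi>. of_real (f \<xi>) * e \<xi>) \<circ> real_of_ereal) \<longlongrightarrow> 0) (at_left \<infinity>)"
        using lim0 lim by (auto simp: ereal_tendsto_simps)
    qed simp
    then have "(LBINT \<xi>. of_real (f' \<xi>) * e \<xi> + \<i> * of_real x * (of_real (f \<xi>) * e \<xi>)) = 0"
      by (simp add: interval_lebesgue_integral_def set_lebesgue_integral_def)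
    then have "(LBINT \<xi>. of_real (f' \<xi>) * e \<xi>) + \<i> * of_real x * (LBINT \<xi>. of_real (f \<xi>) * e \<xi>) = 0"
      using i by simp
    \<comment> \<open>Taking norms turns the factor \<open>\<i> * x\<close> into
      \<open>\<bar>x\<bar>\<close>; dividing by it gains the new power.\<close>
    from arg_cong[OF add_eq_0_iff[THEN iffD1, OF this], of norm]
    have "norm (\<i> * of_real x * (LBINT \<xi>. of_real (f \<xi>) * e \<xi>)) = norm (LBINT \<xi>. of_real (f' \<xi>) * e \<xi>)"
      by simp
    also have "\<dots> \<le> C / \<bar>x\<bar> ^ k" using C[OF that] by (simp add: e_def)
    finally show ?thesis using that unfolding e_def[symmetric] by (simp add: norm_mult field_simps)
  qed
  then show ?case by blast
qed

subsection \<open>Periodization\<close>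

text \<open>The enumeration satisfies \<open>\<bar>int_decode n\<bar> \<ge> n / 2 - 1\<close>, so a
  geometric series in \<open>exp (- a / 2)\<close> dominates.\<close>

lemma summable_exp_int_decode:
  fixes a :: real
  assumes "a > 0"
  shows "summable (\<lambda>n. exp (- a * \<bar>of_int (int_decode n)\<bar>))"
proof (rule summable_comparison_test')
  show "summable (\<lambda>n. exp a * exp (- a / 2) ^ n)"
    using assms by (intro summable_mult summable_geometric) simp
  show "norm (exp (- a * \<bar>of_int (int_decode n)\<bar>)) \<le> exp a * exp (- a / 2) ^ n" for n
  proof -
    have "int n \<le> 2 * \<bar>int_decode n\<bar> + 2"
      by (auto simp: int_decode_def sum_decode_def)
    then have "real n / 2 - 1 \<le> \<bar>real_of_int (int_decode n)\<bar>" by linarith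
    then have "a * (real n / 2 - 1) \<le> a * \<bar>of_int (int_decode n)\<bar>"
      using assms by (intro mult_left_mono) auto
    then show ?thesis
      by (simp add: exp_of_nat_mult[symmetric] exp_add[symmetric] algebra_simps)
  qed
qed

text \<open>Passes from unordered sums over the integers to series over \<open>nat\<close>, the
  setting of the Weierstrass test and of termwise differentiation. Absolute summability makes the
  order of summation irrelevant.\<close>

lemma infsum_int_eq_suminf:
  fixes f :: "int \<Rightarrow> real"
  assumes "summable (\<lambda>n. \<bar>f (int_decode n)\<bar>)"
  shows "f summable_on UNIV" "infsum f UNIV = (\<Sum>n. f (int_decode n))"
proof -
  have "((\<lambda>n. f (int_decode n)) has_sum (\<Sum>n. f (int_decode n))) UNIV"
    by (rule norm_summable_imp_has_sum) (use assms summable_rabs_cancel[OF assms] in \<open>simp_all add: summable_sums\<close>)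
  then have "(f has_sum (\<Sum>n. f (int_decode n))) UNIV"
    using has_sum_reindex_bij_betw[OF bij_int_decode, of f] by simp
  then show "f summable_on UNIV" "infsum f UNIV = (\<Sum>n. f (int_decode n))"
    unfolding summable_on_def by (blast, rule infsumI)
qed

definition periodization :: "(real \<Rightarrow> real) \<Rightarrow> real \<Rightarrow> real" where
  "periodization f x = (\<Sum>\<^sub>\<infinity>j::int. f (x + 2 * pi * of_int j))"

lemma periodization_shift: "periodization f (x + 2 * pi * of_int m) = periodization f x"
proof -
  have "bij (\<lambda>j::int. m + j)" by (rule bij_betwI[of _ _ _ "\<lambda>j. j - m"]) auto
  then have "(\<Sum>\<^sub>\<infinity>j::int. f (x + 2 * pi * of_int (m + j))) = periodization f x"
    unfolding periodization_def by (rule infsum_reindex_bij_betw)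
  then show ?thesis by (simp add: periodization_def algebra_simps)
qed

text \<open>Periodicity brings every argument into one compact period, so that extreme values there
  become global bounds.\<close>

lemma periodization_reduce:
  obtains y where "y \<in> {0..2*pi}" "periodization f x = periodization f y"
proof -
  define m where "m = \<lfloor>x / (2*pi)\<rfloor>"
  have "of_int m \<le> x / (2*pi)" "x / (2*pi) < of_int m + 1" by (auto simp: m_def)
  then have "2 * pi * of_int m \<le> x" "x \<le> 2 * pi * (of_int m + 1)"
    by (simp_all add: field_simps)
  then have "x - 2 * pi * of_int m \<in> {0..2*pi}" by (auto simp: algebra_simps)
  moreover have "periodization f x = periodization f (x - 2 * pi * of_int m)"
    using periodization_shift[of f "x - 2 * pi * of_int m" m] by simp
  ultimately show ?thesis using that by blast
qed

context
  fixes f :: "real \<Rightarrow> real" and \<mu> C :: real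
  assumes \<mu>: "\<mu> > 0" and decay: "\<And>x. \<bar>f x\<bar> \<le> C * exp (- \<mu> * \<bar>x\<bar>)"
begin

text \<open>By the reverse triangle inequality a shift by at most \<open>R\<close> costs only the
  factor \<open>exp (\<mu> * R)\<close>. The resulting majorant does not depend on \<open>x\<close>,
  as the Weierstrass test requires.\<close>

lemma periodization_term_bound:
  assumes "\<bar>x\<bar> \<le> R"
  shows "\<bar>f (x + 2 * pi * of_int j)\<bar> \<le> C * exp (\<mu> * R) * exp (- (2 * pi * \<mu>) * \<bar>of_int j\<bar>)"
proof -
  have "2 * pi * \<bar>of_int j\<bar> - R \<le> \<bar>x + 2 * pi * of_int j\<bar>"
    using assms abs_triangle_ineq2[of "2 * pi * of_int j" "-x"] by (simp add: abs_mult add.commute)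
  then have "\<mu> * (2 * pi * \<bar>of_int j\<bar> - R) \<le> \<mu> * \<bar>x + 2 * pi * of_int j\<bar>"
    using \<mu> by (intro mult_left_mono) auto
  then have "exp (- \<mu> * \<bar>x + 2 * pi * of_int j\<bar>) \<le> exp (\<mu> * R) * exp (- (2 * pi * \<mu>) * \<bar>of_int j\<bar>)"
    unfolding exp_add[symmetric] by (simp add: algebra_simps)
  moreover have "C \<ge> 0" using order_trans[OF abs_ge_zero decay[of 0]] by simp
  ultimately have "C * exp (- \<mu> * \<bar>x + 2 * pi * of_int j\<bar>) \<le> C * (exp (\<mu> * R) * exp (- (2 * pi * \<mu>) * \<bar>of_int j\<bar>))"
    by (rule mult_left_mono)
  then show ?thesis using decay[of "x + 2 * pi * of_int j"] by (simp add: mult.assoc)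
qed

lemma summable_periodization_bound:
  "summable (\<lambda>n. C * exp (\<mu> * R) * exp (- (2 * pi * \<mu>) * \<bar>of_int (int_decode n)\<bar>))"
  using \<mu> by (intro summable_mult summable_exp_int_decode) simp

lemma summable_periodization: "summable (\<lambda>n. \<bar>f (x + 2 * pi * of_int (int_decode n))\<bar>)"
  by (rule summable_comparison_test'[OF summable_periodization_bound[of "\<bar>x\<bar>"]])
    (simp only: real_norm_def abs_abs periodization_term_bound[OF order_refl])

lemma periodization_eq_suminf:
  "periodization f = (\<lambda>x. \<Sum>n. f (x + 2 * pi * of_int (int_decode n)))"
  unfolding periodization_def
  using infsum_int_eq_suminf(2)[OF summable_periodization] by (simp add: fun_eq_iff)

lemma uniformly_convergent_periodization:
  "uniformly_convergent_on {-R<..<R} (\<lambda>n x. \<Sum>i<n. f (x + 2 * pi * of_int (int_decode i)))"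
proof (rule Weierstrass_m_test'[OF _ summable_periodization_bound[of R]])
  fix n x assume "x \<in> {-R<..<R}"
  then have "\<bar>x\<bar> \<le> R" by auto
  then show "norm (f (x + 2 * pi * of_int (int_decode n)))
      \<le> C * exp (\<mu> * R) * exp (- (2 * pi * \<mu>) * \<bar>of_int (int_decode n)\<bar>)"
    unfolding real_norm_def by (rule periodization_term_bound)
qed

lemma continuous_on_periodization:
  assumes "continuous_on UNIV f"
  shows "continuous_on UNIV (periodization f)"
proof -
  have "isCont (periodization f) x" for x
  proof -
    \<comment> \<open>Uniform convergence is known on bounded intervals only; an open one around
      \<open>x\<close> suffices, since continuity is local.\<close>
    define S where "S = {-(\<bar>x\<bar> + 1)<..<\<bar>x\<bar> + 1}"
    have "uniform_limit S (\<lambda>n x. \<Sum>i<n. f (x + 2 * pi * of_int (int_decode i))) (periodization f) sequentially"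
      using uniformly_convergent_periodization[of "\<bar>x\<bar> + 1"]
      unfolding periodization_eq_suminf S_def[symmetric] uniformly_convergent_uniform_limit_iff
      by (simp add: suminf_eq_lim)
    moreover have "continuous_on S (\<lambda>x. \<Sum>i<n. f (x + 2 * pi * of_int (int_decode i)))" for n
      by (intro continuous_on_sum continuous_on_compose2[OF assms] continuous_intros) auto
    ultimately have "continuous_on S (periodization f)"
      by (intro uniform_limit_theorem[where F = sequentially]) auto
    then show ?thesis
      by (rule continuous_on_interior) (auto simp: S_def interior_open)
  qed
  then show ?thesis by (simp add: continuous_on_eq_continuous_at)
qed

lemma periodization_bounded:
  assumes "continuous_on UNIV f"
  shows "\<exists>B. \<forall>x. \<bar>periodization f x\<bar> \<le> B"
proof -
  have "compact (periodization f ` {0..2*pi})"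
    by (intro compact_continuous_image continuous_on_subset[OF continuous_on_periodization[OF assms]]) auto
  then have "bounded (periodization f ` {0..2*pi})" by (rule compact_imp_bounded)
  then obtain B where "\<And>y. y \<in> {0..2*pi} \<Longrightarrow> \<bar>periodization f y\<bar> \<le> B"
    unfolding bounded_iff by (auto simp del: atLeastAtMost_iff)
  then show ?thesis by (metis periodization_reduce)
qed

text \<open>The minimum over one period is attained at some \<open>y\<close>, and there the sum of
  positive terms is at least its term \<open>j = 0\<close>, namely \<open>f y > 0\<close>.\<close>

lemma periodization_pos:
  assumes "continuous_on UNIV f" "\<And>x. f x > 0"
  shows "\<exists>\<delta>>0. \<forall>x. periodization f x \<ge> \<delta>"
proof -
  obtain y where y: "\<And>z. z \<in> {0..2*pi} \<Longrightarrow> periodization f y \<le> periodization f z"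
    using continuous_attains_inf[OF _ _ continuous_on_subset[OF continuous_on_periodization[OF assms(1)]], of "{0..2*pi}"]
    by (auto simp del: atLeastAtMost_iff)
  have "sum (\<lambda>j. f (y + 2 * pi * of_int j)) {0} \<le> periodization f y"
    unfolding periodization_def
    by (intro finite_sum_le_infsum infsum_int_eq_suminf(1) summable_periodization) (auto intro: less_imp_le assms(2))
  then have "f y \<le> periodization f y" by simp
  with assms(2)[of y] have "periodization f y > 0" by simp
  moreover have "periodization f x \<ge> periodization f y" for x
    by (metis periodization_reduce y)
  ultimately show ?thesis by blast
qed

end

text \<open>Termwise differentiation, justified by the locally uniform convergence of the series of
  derivatives.\<close>

lemma has_field_derivative_periodization:
  assumes \<mu>: "\<mu> > 0"
    and f: "\<And>x. \<bar>f x\<bar> \<le> C * exp (- \<mu> * \<bar>x\<bar>)" and f': "\<And>x. \<bar>f' x\<bar> \<le> C' * exp (- \<mu> * \<bar>x\<bar>)"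
    and deriv: "\<And>x. (f has_field_derivative f' x) (at x)"
  shows "(periodization f has_field_derivative periodization f' x) (at x)"
proof -
  define S where "S = {-(\<bar>x\<bar> + 1)<..<\<bar>x\<bar> + 1}"
  have "((\<lambda>x. \<Sum>n. f (x + 2 * pi * of_int (int_decode n))) has_field_derivative
      (\<Sum>n. f' (x + 2 * pi * of_int (int_decode n)))) (at x)"
  proof (rule has_field_derivative_series'(2)[where S = S and ?x0.0 = x])
    show "convex S" "x \<in> S" "x \<in> interior S" by (auto simp: S_def interior_open)
    show "uniformly_convergent_on S (\<lambda>n x. \<Sum>i<n. f' (x + 2 * pi * of_int (int_decode i)))"
      unfolding S_def by (rule uniformly_convergent_periodization[OF \<mu> f'])
    show "summable (\<lambda>n. f (x + 2 * pi * of_int (int_decode n)))"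
      by (rule summable_rabs_cancel) (rule summable_periodization[OF \<mu> f])
    show "((\<lambda>x. f (x + 2 * pi * of_int (int_decode n))) has_field_derivative
        f' (y + 2 * pi * of_int (int_decode n))) (at y within S)" for n y
      using deriv[of "y + 2 * pi * of_int (int_decode n)"]
      by (simp add: DERIV_shift has_field_derivative_at_within)
  qed
  then show ?thesis
    unfolding periodization_eq_suminf[OF \<mu> f] periodization_eq_suminf[OF \<mu> f'] .
qed

lemma bounded_derivs_periodization:
  assumes \<mu>: "\<mu> > 0" and "bounded_derivs k (\<lambda>x. exp (- \<mu> * \<bar>x\<bar>)) f"
  shows "bounded_derivs k (\<lambda>x. 1) (periodization f)"
  using assms(2)
proof (induction k arbitrary: f)
  case 0
  obtain C where "\<And>x. \<bar>f x\<bar> \<le> C * exp (- \<mu> * \<bar>x\<bar>)" using bounded_derivs_bound[OF 0] by blast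
  then show ?case
    using continuous_on_periodization[OF \<mu>, of f C] periodization_bounded[OF \<mu>, of f C] 0 by simp
next
  case (Suc k)
  obtain f' where f': "\<And>x. (f has_field_derivative f' x) (at x)" "bounded_derivs k (\<lambda>x. exp (- \<mu> * \<bar>x\<bar>)) f'"
    using Suc.prems by auto
  obtain C where C: "\<And>x. \<bar>f x\<bar> \<le> C * exp (- \<mu> * \<bar>x\<bar>)" using bounded_derivs_bound[OF Suc.prems] by blast
  obtain C' where C': "\<And>x. \<bar>f' x\<bar> \<le> C' * exp (- \<mu> * \<bar>x\<bar>)" using bounded_derivs_bound[OF f'(2)] by blast
  show ?case
  proof (rule bounded_derivs_SucI)
    show "\<exists>B. \<forall>x. \<bar>periodization f x\<bar> \<le> B * 1"
      using periodization_bounded[OF \<mu> C bounded_derivs_continuous[OF Suc.prems]] by simp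
    show "(periodization f has_field_derivative periodization f' x) (at x)" for x
      by (rule has_field_derivative_periodization[OF \<mu> C C' f'(1)])
    show "bounded_derivs k (\<lambda>x. 1) (periodization f')" by (rule Suc.IH[OF f'(2)])
  qed
qed

subsection \<open>The Bessel function as a Gaussian mixture\<close>

lemma exp_half_square: "(exp (x / 2))\<^sup>2 = exp x" for x :: real
  by (simp add: exp_double[symmetric])

lemma exp_minus_half_square: "(exp (- (x / 2)))\<^sup>2 = exp (- x)" for x :: real
  by (simp add: exp_double[symmetric])

section \<open>Derivatives of the Gaussian\<close>

text \<open>Induction along Horner's scheme: half of the exponent \<open>b\<close> pays for the
  remaining polynomial, the other half for the extra factor \<open>u\<close>. Hence \<open>b\<close>
  has to vary in the induction.\<close>

lemma poly_le_exp_square: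
  fixes p :: "real poly"
  assumes "b > 0"
  shows "\<exists>C\<ge>0. \<forall>u. \<bar>poly p u\<bar> \<le> C * exp (b * u\<^sup>2)"
  using assms
proof (induction p arbitrary: b)
  case 0
  then show ?case by auto
next
  case (pCons a p)
  obtain C where C: "C \<ge> 0" "\<And>u. \<bar>poly p u\<bar> \<le> C * exp (b / 2 * u\<^sup>2)"
    using pCons.IH[of "b/2"] pCons.prems by auto
  have "\<bar>poly (pCons a p) u\<bar> \<le> (\<bar>a\<bar> + (1 + 2 / b) * C) * exp (b * u\<^sup>2)" for u
  proof -
    have "\<bar>u\<bar> \<le> 1 + u\<^sup>2"
      using zero_le_power2[of "\<bar>u\<bar> - 1"] zero_le_power2[of u] unfolding power2_diff by simp
    also have "\<dots> \<le> (1 + 2 / b) * (1 + b / 2 * u\<^sup>2)" using pCons.prems by (simp add: field_simps)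
    also have "\<dots> \<le> (1 + 2 / b) * exp (b / 2 * u\<^sup>2)"
      using pCons.prems by (intro mult_left_mono exp_ge_add_one_self) auto
    finally have "\<bar>u\<bar> * \<bar>poly p u\<bar> \<le> ((1 + 2 / b) * exp (b / 2 * u\<^sup>2)) * (C * exp (b / 2 * u\<^sup>2))"
      using C by (intro mult_mono) (auto intro: order_trans[OF abs_ge_zero])
    also have "\<dots> = (1 + 2 / b) * C * exp (b * u\<^sup>2)"
      by (simp add: exp_add[symmetric] field_simps)
    finally have "\<bar>u * poly p u\<bar> \<le> (1 + 2 / b) * C * exp (b * u\<^sup>2)" by (simp add: abs_mult)
    moreover have "\<bar>a\<bar> * 1 \<le> \<bar>a\<bar> * exp (b * u\<^sup>2)"
      using pCons.prems by (intro mult_left_mono) auto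
    ultimately show ?thesis by (simp add: distrib_right)
  qed
  then show ?case using C(1) pCons.prems by (intro exI[of _ "\<bar>a\<bar> + (1 + 2 / b) * C"]) auto
qed

text \<open>Up to the sign \<open>(-1) ^ m\<close> these are the physicists' Hermite polynomials;
  the recursion is the product rule for \<open>p u * exp (- u^2)\<close>.\<close>

primrec gauss_poly :: "nat \<Rightarrow> real poly" where
  "gauss_poly 0 = 1"
| "gauss_poly (Suc m) = pderiv (gauss_poly m) - [:0, 2:] * gauss_poly m"

definition gauss_deriv :: "nat \<Rightarrow> real \<Rightarrow> real" where
  "gauss_deriv m u = poly (gauss_poly m) u * exp (- u\<^sup>2)"

lemma has_field_derivative_gauss_deriv:
  "(gauss_deriv m has_field_derivative gauss_deriv (Suc m) u) (at u)"
  unfolding gauss_deriv_def[abs_def]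
  by (auto intro!: derivative_eq_intros poly_DERIV simp: algebra_simps)

text \<open>Half of the Gaussian absorbs the polynomial; the other half is kept for the decay in
  \<open>\<xi>\<close>.\<close>

lemma gauss_deriv_bound: "\<exists>C\<ge>0. \<forall>u. \<bar>gauss_deriv m u\<bar> \<le> C * exp (- u\<^sup>2 / 2)"
proof -
  obtain C where C: "C \<ge> 0" "\<And>u. \<bar>poly (gauss_poly m) u\<bar> \<le> C * exp (1 / 2 * u\<^sup>2)"
    using poly_le_exp_square[of "1/2" "gauss_poly m"] by auto
  have "\<bar>gauss_deriv m u\<bar> \<le> C * exp (- u\<^sup>2 / 2)" for u
  proof -
    have "\<bar>gauss_deriv m u\<bar> \<le> C * exp (1 / 2 * u\<^sup>2) * exp (- u\<^sup>2)"
      unfolding gauss_deriv_def abs_mult abs_exp_cancel by (intro mult_right_mono C(2)) simp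
    then show ?thesis by (simp add: mult.assoc exp_add[symmetric])
  qed
  then show ?thesis using C(1) by blast
qed

text \<open>The \<open>m\<close>-th derivative in \<open>\<xi>\<close> of \<open>exp (\<nu> * t - exp t - (c * \<xi>)\<^sup>2 / 4 * exp (- t))\<close>.\<close>

definition bessel_kernel :: "real \<Rightarrow> real \<Rightarrow> nat \<Rightarrow> real \<Rightarrow> real \<Rightarrow> real" where
  "bessel_kernel \<nu> c m \<xi> t = (c / 2 * exp (- t / 2)) ^ m * gauss_deriv m (c / 2 * exp (- t / 2) * \<xi>) * exp (\<nu> * t - exp t)"

definition bessel_mixture :: "real \<Rightarrow> real \<Rightarrow> nat \<Rightarrow> real \<Rightarrow> real" where
  "bessel_mixture \<nu> c m \<xi> = (LBINT t. bessel_kernel \<nu> c m \<xi> t)"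

section \<open>Bounds and derivatives of the mixture\<close>

lemma has_field_derivative_bessel_kernel:
  "((\<lambda>\<xi>. bessel_kernel \<nu> c m \<xi> t) has_field_derivative bessel_kernel \<nu> c (Suc m) \<xi> t) (at \<xi>)"
proof -
  define s where "s = c / 2 * exp (- t / 2)"
  have "((\<lambda>\<xi>. gauss_deriv m (s * \<xi>)) has_field_derivative gauss_deriv (Suc m) (s * \<xi>) * s) (at \<xi>)"
    by (rule DERIV_chain2[OF has_field_derivative_gauss_deriv]) (auto intro!: derivative_eq_intros)
  then show ?thesis
    unfolding bessel_kernel_def s_def[symmetric]
    by (auto intro!: derivative_eq_intros simp: mult_ac)
qed

lemma borel_measurable_bessel_kernel [measurable]: "bessel_kernel \<nu> c m \<xi> \<in> borel_measurable borel"
proof -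
  have "continuous_on UNIV (gauss_deriv m)"
    by (rule DERIV_continuous_on) (rule has_field_derivative_at_within[OF has_field_derivative_gauss_deriv])
  then have [measurable]: "gauss_deriv m \<in> borel_measurable borel"
    by (rule borel_measurable_continuous_onI)
  show ?thesis unfolding bessel_kernel_def[abs_def] by measurable
qed

text \<open>The factor \<open>exp (- c * \<bar>\<xi>\<bar> / 2)\<close> is AM-GM for the exponents \<open>c\<^sup>2 \<xi>\<^sup>2 exp (- t) / 8\<close> and \<open>exp t / 2\<close>.\<close>

lemma bessel_kernel_bound:
  assumes "c > 0"
  shows "\<exists>C\<ge>0. \<forall>\<xi> t. \<bar>bessel_kernel \<nu> c m \<xi> t\<bar> \<le>
    C * exp (- (c / 2) * \<bar>\<xi>\<bar>) * exp ((\<nu> - m / 2) * t - 1 / 2 * exp t)"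
proof -
  obtain C where C: "C \<ge> 0" "\<And>u. \<bar>gauss_deriv m u\<bar> \<le> C * exp (- u\<^sup>2 / 2)"
    using gauss_deriv_bound by blast
  have "\<bar>bessel_kernel \<nu> c m \<xi> t\<bar> \<le>
      C * (c / 2) ^ m * exp (- (c / 2) * \<bar>\<xi>\<bar>) * exp ((\<nu> - m / 2) * t - 1 / 2 * exp t)" for \<xi> t
  proof -
    define s where "s = c / 2 * exp (- t / 2)"
    have s: "s > 0" using assms by (simp add: s_def)
    have "0 \<le> (s * \<bar>\<xi>\<bar> - exp (t / 2))\<^sup>2 / 2" by simp
    also have "\<dots> = (s * \<xi>)\<^sup>2 / 2 + exp t / 2 - c / 2 * \<bar>\<xi>\<bar>"
    proof -
      \<comment> \<open>The cross term of the square does not depend on \<open>t\<close>, so the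
        decay in \<open>\<xi>\<close> can leave the integral.\<close>
      have "s * exp (t / 2) = c / 2" by (simp add: s_def exp_add[symmetric])
      then have "s * (\<bar>\<xi>\<bar> * exp (t / 2)) = c / 2 * \<bar>\<xi>\<bar>" by (metis mult.left_commute mult.commute)
      then show ?thesis by (simp add: power2_diff power_mult_distrib exp_half_square diff_divide_distrib add_divide_distrib)
    qed
    finally have amgm: "c / 2 * \<bar>\<xi>\<bar> \<le> (s * \<xi>)\<^sup>2 / 2 + exp t / 2" by simp
    have "\<bar>bessel_kernel \<nu> c m \<xi> t\<bar> \<le> s ^ m * (C * exp (- (s * \<xi>)\<^sup>2 / 2)) * exp (\<nu> * t - exp t)"
      unfolding bessel_kernel_def s_def[symmetric] abs_mult
      using s C by (simp add: mult_left_mono)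
    also have "\<dots> = C * s ^ m * exp (\<nu> * t - exp t - (s * \<xi>)\<^sup>2 / 2)"
      by (simp add: exp_add[symmetric] algebra_simps)
    also have "\<dots> \<le> C * s ^ m * exp (\<nu> * t - exp t / 2 - c / 2 * \<bar>\<xi>\<bar>)"
      using amgm C(1) s by (intro mult_left_mono) auto
    \<comment> \<open>The price of \<open>m\<close> derivatives: the coefficient of \<open>t\<close>
      drops from \<open>\<nu>\<close> to \<open>\<nu> - m / 2\<close>.\<close>
    also have "s ^ m = (c / 2) ^ m * exp (- m / 2 * t)"
      by (simp add: s_def power_mult_distrib power_divide exp_of_nat_mult[symmetric])
    also have "C * ((c / 2) ^ m * exp (- m / 2 * t)) * exp (\<nu> * t - exp t / 2 - c / 2 * \<bar>\<xi>\<bar>) =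
        C * (c / 2) ^ m * exp (- m / 2 * t + (\<nu> * t - exp t / 2 - c / 2 * \<bar>\<xi>\<bar>))"
      by (simp only: exp_add mult_ac)
    also have "- m / 2 * t + (\<nu> * t - exp t / 2 - c / 2 * \<bar>\<xi>\<bar>) =
        - (c / 2) * \<bar>\<xi>\<bar> + ((\<nu> - m / 2) * t - 1 / 2 * exp t)"
      by (simp add: algebra_simps)
    finally show ?thesis by (simp only: exp_add mult_ac)
  qed
  then show ?thesis using C(1) assms by (intro exI[of _ "C * (c / 2) ^ m"]) auto
qed

text \<open>The condition \<open>m < 2 * \<nu>\<close> keeps the coefficient
  \<open>\<nu> - m / 2\<close> positive, hence \<open>w\<close> integrable. The first bound yields
  decay of the mixture, the second is the majorant uniform in \<open>\<xi>\<close> for dominated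
  convergence.\<close>

lemma bessel_kernel_dominated:
  assumes "c > 0" "real m < 2 * \<nu>"
  obtains w where "\<And>\<xi> t. \<bar>bessel_kernel \<nu> c m \<xi> t\<bar> \<le> exp (- (c / 2) * \<bar>\<xi>\<bar>) * w t"
    "\<And>\<xi> t. \<bar>bessel_kernel \<nu> c m \<xi> t\<bar> \<le> w t" "integrable lborel w"
proof -
  obtain C where C: "C \<ge> 0" "\<And>\<xi> t. \<bar>bessel_kernel \<nu> c m \<xi> t\<bar> \<le>
      C * exp (- (c / 2) * \<bar>\<xi>\<bar>) * exp ((\<nu> - m / 2) * t - 1 / 2 * exp t)"
    using bessel_kernel_bound[OF assms(1)] by blast
  define w where "w t = C * exp ((\<nu> - m / 2) * t - 1 / 2 * exp t)" for t
  have 1: "\<bar>bessel_kernel \<nu> c m \<xi> t\<bar> \<le> exp (- (c / 2) * \<bar>\<xi>\<bar>) * w t" for \<xi> t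
    using C(2)[of \<xi> t] by (simp add: w_def mult_ac)
  have "w t \<ge> 0" for t using C(1) by (simp add: w_def)
  then have "exp (- (c / 2) * \<bar>\<xi>\<bar>) * w t \<le> 1 * w t" for \<xi> t
    using assms(1) by (intro mult_right_mono) auto
  then have 2: "\<bar>bessel_kernel \<nu> c m \<xi> t\<bar> \<le> w t" for \<xi> t
    using 1[of \<xi> t] by (metis mult_1 order_trans)
  have "integrable lborel w"
    unfolding w_def by (intro integrable_mult_right integrable_exp_minus_exp) (use assms in auto)
  with 1 2 show ?thesis by (rule that)
qed

lemma integrable_bessel_kernel:
  assumes "c > 0" "real m < 2 * \<nu>"
  shows "integrable lborel (bessel_kernel \<nu> c m \<xi>)"
proof -
  obtain w where w: "\<And>\<xi> t. \<bar>bessel_kernel \<nu> c m \<xi> t\<bar> \<le> exp (- (c / 2) * \<bar>\<xi>\<bar>) * w t"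
      "\<And>\<xi> t. \<bar>bessel_kernel \<nu> c m \<xi> t\<bar> \<le> w t" "integrable lborel w"
    by (rule bessel_kernel_dominated[OF assms]) (rule that)
  show ?thesis
    by (rule Bochner_Integration.integrable_bound[OF w(3)])
      (use order_trans[OF w(2) abs_ge_self] in simp_all)
qed

lemma bessel_mixture_bound:
  assumes "c > 0" "real m < 2 * \<nu>"
  shows "\<exists>C. \<forall>\<xi>. \<bar>bessel_mixture \<nu> c m \<xi>\<bar> \<le> C * exp (- (c / 2) * \<bar>\<xi>\<bar>)"
proof -
  obtain w where w: "\<And>\<xi> t. \<bar>bessel_kernel \<nu> c m \<xi> t\<bar> \<le> exp (- (c / 2) * \<bar>\<xi>\<bar>) * w t"
      "\<And>\<xi> t. \<bar>bessel_kernel \<nu> c m \<xi> t\<bar> \<le> w t" "integrable lborel w"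
    by (rule bessel_kernel_dominated[OF assms]) (rule that)
  have "\<bar>bessel_mixture \<nu> c m \<xi>\<bar> \<le> (LBINT t. exp (- (c / 2) * \<bar>\<xi>\<bar>) * w t)" for \<xi>
    unfolding bessel_mixture_def real_norm_def[symmetric]
    by (rule Bochner_Integration.integral_norm_bound_integral[OF integrable_bessel_kernel[OF assms]])
      (use w in simp_all)
  then show ?thesis using w(3) by (intro exI[of _ "LBINT t. w t"]) (simp add: mult.commute)
qed

text \<open>Differentiating under the integral raises \<open>m\<close> by one and lowers
  \<open>k\<close> by one; \<open>m + k\<close> is unchanged, so the integrability condition
  survives the induction.\<close>

lemma bounded_derivs_bessel_mixture:
  assumes "c > 0" "real (m + k) < 2 * \<nu>"
  shows "bounded_derivs k (\<lambda>\<xi>. exp (- (c / 2) * \<bar>\<xi>\<bar>)) (bessel_mixture \<nu> c m)"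
  using assms(2)
proof (induction k arbitrary: m)
  case 0
  then have m: "real m < 2 * \<nu>" by simp
  obtain w where w: "\<And>\<xi> t. \<bar>bessel_kernel \<nu> c m \<xi> t\<bar> \<le> exp (- (c / 2) * \<bar>\<xi>\<bar>) * w t"
      "\<And>\<xi> t. \<bar>bessel_kernel \<nu> c m \<xi> t\<bar> \<le> w t" "integrable lborel w"
    by (rule bessel_kernel_dominated[OF assms(1) m]) (rule that)
  have "continuous_on UNIV (bessel_mixture \<nu> c m)"
    unfolding bessel_mixture_def[abs_def]
  proof (rule continuous_on_integral_dominated[OF _ _ w(2,3)])
    show "continuous_on UNIV (\<lambda>\<xi>. bessel_kernel \<nu> c m \<xi> t)" for t
      by (rule DERIV_continuous_on) (rule has_field_derivative_at_within[OF has_field_derivative_bessel_kernel])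
  qed simp
  then show ?case using bessel_mixture_bound[OF assms(1) m] by simp
next
  case (Suc k)
  then have m: "real m < 2 * \<nu>" "real (Suc m) < 2 * \<nu>" by simp_all
  obtain w where w: "\<And>\<xi> t. \<bar>bessel_kernel \<nu> c (Suc m) \<xi> t\<bar> \<le> exp (- (c / 2) * \<bar>\<xi>\<bar>) * w t"
      "\<And>\<xi> t. \<bar>bessel_kernel \<nu> c (Suc m) \<xi> t\<bar> \<le> w t" "integrable lborel w"
    by (rule bessel_kernel_dominated[OF assms(1) m(2)]) (rule that)
  show ?case
  proof (rule bounded_derivs_SucI[OF bessel_mixture_bound[OF assms(1) m(1)]])
    show "(bessel_mixture \<nu> c m has_field_derivative bessel_mixture \<nu> c (Suc m) \<xi>) (at \<xi>)" for \<xi>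
      unfolding bessel_mixture_def[abs_def]
      by (rule has_field_derivative_integral_dominated[OF integrable_bessel_kernel[OF assms(1) m(1)]
          has_field_derivative_bessel_kernel _ w(2,3)]) simp
    show "bounded_derivs k (\<lambda>\<xi>. exp (- (c / 2) * \<bar>\<xi>\<bar>)) (bessel_mixture \<nu> c (Suc m))"
      using Suc.prems by (intro Suc.IH) simp
  qed
qed

section \<open>From the Bessel function to the mixture\<close>

lemma bessel_kernel_0: "bessel_kernel \<nu> c 0 \<xi> t = exp (\<nu> * t - exp t - (c * \<xi>)\<^sup>2 / 4 * exp (- t))"
proof -
  have "(c * \<xi> * exp (- t / 2) / 2)\<^sup>2 = (c * \<xi>)\<^sup>2 / 4 * exp (- t)"
    by (simp add: power_mult_distrib power_divide exp_minus_half_square)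
  then show ?thesis
    by (simp add: bessel_kernel_def gauss_deriv_def exp_add[symmetric] mult_ac)
qed

lemma bessel_mixture_pos:
  assumes "c > 0" "\<nu> > 0"
  shows "bessel_mixture \<nu> c 0 \<xi> > 0"
proof -
  have i: "integrable lborel (bessel_kernel \<nu> c 0 \<xi>)" using assms by (intro integrable_bessel_kernel) auto
  have pos: "bessel_kernel \<nu> c 0 \<xi> t > 0" for t by (simp add: bessel_kernel_0)
  \<comment> \<open>A vanishing integral would force the strictly positive kernel to be zero almost
    everywhere; this upgrades nonnegativity to positivity.\<close>
  have "\<not> (AE t in lborel. bessel_kernel \<nu> c 0 \<xi> t = 0)"
  proof
    assume "AE t in lborel. bessel_kernel \<nu> c 0 \<xi> t = 0"
    then have "AE t in (lborel :: real measure). False"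
      by (rule AE_mp) (use pos in \<open>auto simp: less_le\<close>)
    then show False by (simp add: AE_iff_null null_sets_def)
  qed
  moreover have "AE t in lborel. 0 \<le> bessel_kernel \<nu> c 0 \<xi> t" using pos by (auto intro: less_imp_le)
  ultimately show ?thesis
    unfolding bessel_mixture_def using integral_nonneg_eq_0_iff_AE[OF i] integral_nonneg_AE
    by (metis less_le)
qed

text \<open>In \<open>r * cosh t = r / 2 * (exp t + exp (- t))\<close> the translation of \<open>t\<close> by \<open>ln (r / 2)\<close> moves all
  dependence on \<open>r\<close> to the second exponential, up to a power of \<open>r\<close>.\<close>

lemma bessel_K_eq_mixture:
  assumes "\<nu> > 0" "c > 0" "\<xi> \<noteq> 0"
  shows "bessel_K (- \<nu>) (c * \<bar>\<xi>\<bar>) = 1 / 2 * (c * \<bar>\<xi>\<bar> / 2) powr (- \<nu>) * bessel_mixture \<nu> c 0 \<xi>"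
proof -
  define r where "r = c * \<bar>\<xi>\<bar>"
  have r: "r > 0" using assms by (simp add: r_def)
  define h where "h t = exp (\<nu> * t - r * cosh t)" for t
  have shift: "h (- ln (r / 2) + 1 * s) = (r / 2) powr (- \<nu>) * bessel_kernel \<nu> c 0 \<xi> s" for s
  proof -
    have "r * cosh (s - ln (r / 2)) = exp s + (c * \<xi>)\<^sup>2 / 4 * exp (- s)"
      using r by (simp add: cosh_def exp_diff exp_add field_simps exp_minus power2_eq_square)
        (simp add: r_def abs_mult_self_eq)
    then show ?thesis using r
      by (simp add: h_def bessel_kernel_0 powr_def exp_add[symmetric] algebra_simps)
  qed
  have ik: "integrable lborel (bessel_kernel \<nu> c 0 \<xi>)" using assms by (intro integrable_bessel_kernel) auto
  have "integrable lborel (\<lambda>s. h (- ln (r / 2) + 1 * s))"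
    unfolding shift using ik by simp
  then have ih: "integrable lborel h"
    by (subst (asm) lborel_integrable_real_affine_iff) auto
  have ih': "integrable lborel (\<lambda>t. h (- t))"
    using lborel_integrable_real_affine[OF ih, of "-1" 0] by simp
  have Lh: "(LBINT t. h t) = (r / 2) powr (- \<nu>) * bessel_mixture \<nu> c 0 \<xi>"
    using lborel_integral_real_affine[of 1 h "- ln (r / 2)"] unfolding shift
    by (simp add: bessel_mixture_def)
  have ind: "integrable lborel (\<lambda>t. indicator A t * g t)"
    if "integrable lborel g" "A \<in> sets borel" for g :: "real \<Rightarrow> real" and A
    using integrable_mult_indicator[of A lborel g] that by simp
  \<comment> \<open>The line is folded at \<open>0\<close>: \<open>h t + h (- t)\<close> is twice
    the integrand of \<open>bessel_K\<close>.\<close>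
  have "(LBINT t. h t) = (LBINT t. indicator {0..} t * h t + indicator {..<0} t * h t)"
    by (intro Bochner_Integration.integral_cong) (auto simp: indicator_def)
  also have "\<dots> = (LBINT t. indicator {0..} t * h t) + (LBINT t. indicator {..<0} t * h t)"
    by (intro Bochner_Integration.integral_add ind ih) auto
  also have "(LBINT t. indicator {..<0} t * h t) = (LBINT t. indicator {..<0} (- t) * h (- t))"
    using lborel_integral_real_affine[of "-1" "\<lambda>t. indicator {..<0} t * h t" 0] by simp
  \<comment> \<open>After reflection the two half-lines differ only in the point
    \<open>0\<close>.\<close>
  also have "\<dots> = (LBINT t. indicator {0..} t * h (- t))"
    by (rule integral_discrete_difference[of "{0}"]) (auto simp: indicator_def)
  also have "(LBINT t. indicator {0..} t * h t) + (LBINT t. indicator {0..} t * h (- t)) =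
      (LBINT t. indicator {0..} t * h t + indicator {0..} t * h (- t))"
    by (intro Bochner_Integration.integral_add[symmetric] ind ih ih') auto
  also have "\<dots> = (LBINT t. 2 * (indicator {0..} t * (exp (- r * cosh t) * cosh (- \<nu> * t))))"
  proof (rule Bochner_Integration.integral_cong[OF refl])
    fix t
    have "h t = exp (- r * cosh t) * exp (\<nu> * t)" "h (- t) = exp (- r * cosh t) * exp (- (\<nu> * t))"
      by (simp_all add: h_def exp_add[symmetric])
    then have "h t + h (- t) = 2 * (exp (- r * cosh t) * cosh (- \<nu> * t))"
      by (simp add: cosh_field_def[of "\<nu> * t"] distrib_left)
    then show "indicator {0..} t * h t + indicator {0..} t * h (- t) =
        2 * (indicator {0..} t * (exp (- r * cosh t) * cosh (- \<nu> * t)))"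
      unfolding distrib_left[symmetric] by simp
  qed
  also have "\<dots> = 2 * bessel_K (- \<nu>) r"
    by (simp add: bessel_K_def set_lebesgue_integral_def)
  finally show ?thesis using Lh by (simp add: r_def)
qed

text \<open>The powers of \<open>\<bar>\<xi>\<bar>\<close> in the prefactor and in
  \<open>bessel_K_eq_mixture\<close> cancel and leave \<open>(c^2 / 2) powr (- \<nu>)\<close>. The
  right-hand side is thereby smooth also across the origin.\<close>

lemma mq_hat_eq_mixture:
  assumes "\<alpha> < - 1 / 2" "c > 0"
  obtains K where "K > 0" "\<And>\<xi>. \<xi> \<noteq> 0 \<Longrightarrow> mq_hat \<alpha> c \<xi> = K * bessel_mixture (- \<alpha> - 1 / 2) c 0 \<xi>"
proof -
  define \<nu> where "\<nu> = - \<alpha> - 1 / 2"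
  have \<nu>: "\<nu> > 0" "\<alpha> + 1 / 2 = - \<nu>" using assms by (auto simp: \<nu>_def)
  define K where "K = 2 powr (1 + \<alpha>) / Gamma (- \<alpha>) * (1 / 2 * (c\<^sup>2 / 2) powr (- \<nu>))"
  have "K > 0" using assms by (auto simp: K_def intro!: mult_pos_pos divide_pos_pos Gamma_real_pos)
  moreover have "mq_hat \<alpha> c \<xi> = K * bessel_mixture \<nu> c 0 \<xi>" if "\<xi> \<noteq> 0" for \<xi>
  proof -
    have "(c / \<bar>\<xi>\<bar>) powr (- \<nu>) * (c * \<bar>\<xi>\<bar> / 2) powr (- \<nu>) = (c / \<bar>\<xi>\<bar> * (c * \<bar>\<xi>\<bar> / 2)) powr (- \<nu>)"
      using assms(2) by (intro powr_mult[symmetric])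
    also have "c / \<bar>\<xi>\<bar> * (c * \<bar>\<xi>\<bar> / 2) = c\<^sup>2 / 2"
      using that by (simp add: power2_eq_square)
    finally have powr: "(c\<^sup>2 / 2) powr (- \<nu>) = (c / \<bar>\<xi>\<bar>) powr (- \<nu>) * (c * \<bar>\<xi>\<bar> / 2) powr (- \<nu>)" ..
    show ?thesis
      unfolding mq_hat_def \<nu>(2) bessel_K_eq_mixture[OF \<nu>(1) assms(2) that] K_def powr
      by (simp only: mult_ac)
  qed
  ultimately show ?thesis using that by (simp add: \<nu>_def)
qed

subsection \<open>Decay of the fundamental function\<close>

lemma countable_pi_multiples: "countable {\<xi>. \<exists>k::int. \<xi> = 2 * pi * of_int k}"
proof -
  have "{\<xi>. \<exists>k::int. \<xi> = 2 * pi * of_int k} = range (\<lambda>k::int. 2 * pi * of_int k)" by auto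
  then show ?thesis by simp
qed

text \<open>Off the lattice no shifted argument is \<open>0\<close>, so the mixture formula holds
  for every term of the denominator, and the common factor \<open>K\<close> cancels.\<close>

lemma fundamental_hat_eq_quotient:
  assumes "\<alpha> < - 1 / 2" "c > 0" "\<nexists>k::int. \<xi> = 2 * pi * of_int k"
  defines "\<Phi> \<equiv> bessel_mixture (- \<alpha> - 1 / 2) c 0"
  shows "fundamental_hat \<alpha> c \<xi> = \<Phi> \<xi> / periodization \<Phi> \<xi>"
proof -
  obtain K where K: "K > 0" "\<And>\<xi>. \<xi> \<noteq> 0 \<Longrightarrow> mq_hat \<alpha> c \<xi> = K * \<Phi> \<xi>"
    by (rule mq_hat_eq_mixture[OF assms(1,2), folded \<Phi>_def]) (rule that)
  have nz: "\<xi> + 2 * pi * of_int j \<noteq> 0" for j :: int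
  proof
    assume "\<xi> + 2 * pi * of_int j = 0"
    then have "\<xi> = 2 * pi * of_int (- j)" by simp
    with assms(3) show False by blast
  qed
  have "(\<Sum>\<^sub>\<infinity>j::int. mq_hat \<alpha> c (\<xi> + 2 * pi * of_int j)) = K * periodization \<Phi> \<xi>"
    unfolding K(2)[OF nz] infsum_cmult_right' periodization_def ..
  moreover have "mq_hat \<alpha> c \<xi> = K * \<Phi> \<xi>" using K(2) nz[of 0] by simp
  ultimately show ?thesis
    using K(1) assms(3) by (simp add: fundamental_hat_def mq_quotient_def)
qed

theorem corollary13:
  fixes \<alpha> c :: real
  assumes "\<alpha> < -1" and "c \<ge> 1"
  shows "fundamental \<alpha> c
           \<in> O[at_infinity](\<lambda>x. of_real (\<bar>x\<bar> powi (- \<lceil>2 * \<bar>\<alpha>\<bar> - 2\<rceil>)))"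
proof -
  define \<nu> where "\<nu> = - \<alpha> - 1 / 2"
  define k where "k = nat \<lceil>2 * \<bar>\<alpha>\<bar> - 2\<rceil>"
  have k: "int k = \<lceil>2 * \<bar>\<alpha>\<bar> - 2\<rceil>" unfolding k_def using assms(1) by simp
  \<comment> \<open>The ceiling exceeds its argument by less than one, and
    \<open>2 * \<bar>\<alpha>\<bar> - 1 = 2 * \<nu>\<close>; so \<open>k\<close> is an admissible
    number of derivatives.\<close>
  have "real k < 2 * \<bar>\<alpha>\<bar> - 2 + 1" using ceiling_correct[of "2 * \<bar>\<alpha>\<bar> - 2"] k by linarith
  then have k\<nu>: "real k < 2 * \<nu>" using assms(1) by (simp add: \<nu>_def)
  have \<nu>: "\<nu> > 0" and c: "c > 0" using assms by (auto simp: \<nu>_def)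
  define w where "w \<xi> = exp (- (c / 2) * \<bar>\<xi>\<bar>)" for \<xi>
  define \<Phi> where "\<Phi> = bessel_mixture \<nu> c 0"
  have \<Phi>: "bounded_derivs k w \<Phi>"
    unfolding \<Phi>_def w_def using bounded_derivs_bessel_mixture[of c 0 k \<nu>] c k\<nu> by simp
  obtain C where C: "\<And>\<xi>. \<bar>\<Phi> \<xi>\<bar> \<le> C * exp (- (c / 2) * \<bar>\<xi>\<bar>)"
    using bounded_derivs_bound[OF \<Phi>] unfolding w_def by blast
  have c2: "c / 2 > 0" using c by simp
  obtain \<delta> where \<delta>: "\<delta> > 0" "\<And>\<xi>. periodization \<Phi> \<xi> \<ge> \<delta>"
    using periodization_pos[OF c2 C bounded_derivs_continuous[OF \<Phi>]] bessel_mixture_pos[OF c \<nu>]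
    unfolding \<Phi>_def by blast
  \<comment> \<open>The numerator contributes the decaying weight \<open>w\<close>; the inverted
    periodization, bounded below by \<open>\<delta>\<close>, contributes the constant weight
    \<open>1\<close>.\<close>
  have "bounded_derivs k (\<lambda>\<xi>. w \<xi> * 1) (\<lambda>\<xi>. \<Phi> \<xi> * inverse (periodization \<Phi> \<xi>))"
    using \<Phi> by (intro bounded_derivs_mult bounded_derivs_inverse[OF _ \<delta>] bounded_derivs_periodization[OF c2])
      (simp_all add: w_def[abs_def])
  then have Q: "bounded_derivs k w (\<lambda>\<xi>. \<Phi> \<xi> / periodization \<Phi> \<xi>)"
    by (simp add: divide_inverse)
  have "(w \<longlongrightarrow> 0) at_top" "(w \<longlongrightarrow> 0) at_bot"
    unfolding w_def using c by real_asymp+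
  then obtain B where B: "\<And>x. x \<noteq> 0 \<Longrightarrow>
      norm (LBINT \<xi>. of_real (\<Phi> \<xi> / periodization \<Phi> \<xi>) * exp (\<i> * of_real x * of_real \<xi>)) \<le> B / \<bar>x\<bar> ^ k"
    using fourier_integral_bound[OF Q] integrable_exp_abs[OF c2] unfolding w_def by blast
  have "norm (fundamental \<alpha> c x) \<le> B / (2 * pi) * norm (of_real (\<bar>x\<bar> powi (- \<lceil>2 * \<bar>\<alpha>\<bar> - 2\<rceil>)) :: complex)"
    if "x \<noteq> 0" for x
  proof -
    have "(LBINT \<xi>. of_real (fundamental_hat \<alpha> c \<xi>) * exp (\<i> * of_real x * of_real \<xi>)) =
        (LBINT \<xi>. of_real (\<Phi> \<xi> / periodization \<Phi> \<xi>) * exp (\<i> * of_real x * of_real \<xi>))"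
    proof (rule integral_discrete_difference[OF countable_pi_multiples])
      fix \<xi> assume "\<xi> \<notin> {\<xi>. \<exists>k::int. \<xi> = 2 * pi * of_int k}"
      then show "of_real (fundamental_hat \<alpha> c \<xi>) * exp (\<i> * of_real x * of_real \<xi>) =
          of_real (\<Phi> \<xi> / periodization \<Phi> \<xi>) * exp (\<i> * of_real x * of_real \<xi>)"
        using fundamental_hat_eq_quotient[of \<alpha> c \<xi>] assms(1) c by (simp add: \<Phi>_def \<nu>_def)
    qed auto
    then have "norm (fundamental \<alpha> c x) = 1 / (2 * pi) *
        norm (LBINT \<xi>. of_real (\<Phi> \<xi> / periodization \<Phi> \<xi>) * exp (\<i> * of_real x * of_real \<xi>))"
      unfolding fundamental_def norm_mult by (simp only:) (simp add: norm_divide norm_mult)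
    also have "\<dots> \<le> 1 / (2 * pi) * (B / \<bar>x\<bar> ^ k)"
      by (intro mult_left_mono B that) simp
    also have "1 / (2 * pi) * (B / \<bar>x\<bar> ^ k) = B / (2 * pi) * inverse (\<bar>x\<bar> ^ k)"
      by (simp only: divide_inverse mult_1_left mult_ac)
    also have "inverse (\<bar>x\<bar> ^ k) = norm (of_real (\<bar>x\<bar> powi (- \<lceil>2 * \<bar>\<alpha>\<bar> - 2\<rceil>)) :: complex)"
      unfolding k[symmetric] power_int_minus power_int_of_nat norm_of_real by simp
    finally show ?thesis .
  qed
  then show ?thesis
    by (intro bigoI[of _ "B / (2 * pi)"] eventually_mono[OF eventually_not_equal_at_infinity[of 0]]) auto
qed

end
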